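(* Let $(H;(\cdot,\cdot))$ be an inner product space over $\mathbb{K}$ and let $x,y_1,\dots,y_n\in H$. Let $p>1$ and $\frac1p+\frac1q=1$. Put $$S_i:=\sum_{j=1}^n|(y_i,y_j)|\quad(1\le i\le n),\qquad S:=\sum_{i,j=1}^n|(y_i,y_j)|.$$ Then $$\sum_{i=1}^n|(x,y_i)|^2\le\|x\|\left[\sum_{i=1}^n|(x,y_i)|^pS_i\right]^{\frac1{2p}}\left[\sum_{i=1}^n|(x,y_i)|^qS_i\right]^{\frac1{2q}},$$ and the right-hand side of this inequality is less than or equal to $\|x\|\,B$, where $B$ is any one of the following nine quantities, and where $\alpha,\beta$ are any reals with $\alpha>1$, $\frac1\alpha+\frac1\beta=1$, and $\gamma,\delta$ are any reals with $\gamma>1$, $\frac1\gamma+\frac1\delta=1$ (whenever they occur): (1) $\max_{1\le i\le n}|(x,y_i)|\,S^{\frac12}$; (2) $\max_{1\le i\le n}|(x,y_i)|^{\frac12}\left(\sum_{i=1}^n|(x,y_i)|^{\gamma q}\right)^{\frac1{2\gamma q}}S^{\frac1{2p}}\left(\sum_{i=1}^nS_i^{\delta}\right)^{\frac1{2\delta q}}$; (3) $\max_{1\le i\le n}|(x,y_i)|^{\frac12}\left(\sum_{i=1}^n|(x,y_i)|^{q}\right)^{\frac1{2q}}S^{\frac1{2p}}\max_{1\le i\le n}S_i^{\frac1{2q}}$; (4) $\max_{1\le i\le n}|(x,y_i)|^{\frac12}\left(\sum_{i=1}^n|(x,y_i)|^{\alpha p}\right)^{\frac1{2\alpha p}}S^{\frac1{2q}}\left(\sum_{i=1}^nS_i^{\beta}\right)^{\frac1{2p\beta}}$;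 (5) $\left(\sum_{i=1}^n|(x,y_i)|^{\alpha p}\right)^{\frac1{2\alpha p}}\left(\sum_{i=1}^n|(x,y_i)|^{\gamma q}\right)^{\frac1{2\gamma q}}\left(\sum_{i=1}^nS_i^{\beta}\right)^{\frac1{2p\beta}}\left(\sum_{i=1}^nS_i^{\delta}\right)^{\frac1{2\delta q}}$; (6) $\left(\sum_{i=1}^n|(x,y_i)|^{q}\right)^{\frac1{2q}}\left(\sum_{i=1}^n|(x,y_i)|^{\alpha p}\right)^{\frac1{2\alpha p}}\max_{1\le i\le n}S_i^{\frac1{2q}}\left(\sum_{i=1}^nS_i^{\beta}\right)^{\frac1{2p\beta}}$; (7) $\max_{1\le i\le n}|(x,y_i)|^{\frac12}\left(\sum_{i=1}^n|(x,y_i)|^{p}\right)^{\frac1{2p}}\max_{1\le i\le n}S_i^{\frac1{2p}}\;S^{\frac1{2q}}$; (8) $\left(\sum_{i=1}^n|(x,y_i)|^{p}\right)^{\frac1{2p}}\left(\sum_{i=1}^n|(x,y_i)|^{\gamma q}\right)^{\frac1{2\gamma q}}\max_{1\le i\le n}S_i^{\frac1{2p}}\left(\sum_{i=1}^nS_i^{\delta}\right)^{\frac1{2\delta q}}$; (9) $\left(\sum_{i=1}^n|(x,y_i)|^{p}\right)^{\frac1{2p}}\left(\sum_{i=1}^n|(x,y_i)|^{q}\right)^{\frac1{2q}}\max_{1\le i\le n}S_i^{\frac12}$.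
   Context: $\mathbb{K}$ denotes the scalar field of $H$, either $\mathbb{R}$ or $\mathbb{C}$; the inner product is linear in the first argument and conjugate-linear in the second; $\|x\|=\sqrt{(x,x)}$; $n\ge1$ is an integer. *)

theory Defs
  imports "HOL-Analysis.Analysis"
begin

text \<open>
  The scalar fields of inner product spaces. Up to isometric isomorphism the only instances are
  the reals, with trivial conjugation, and the complex numbers, with the usual conjugation;
  see \<open>real_or_complex_cases\<close> below.
\<close>

class real_or_complex = real_normed_field +
  fixes kcnj :: "'a \<Rightarrow> 'a"
  assumes kcnj_add: "kcnj (a + b) = kcnj a + kcnj b"
    and kcnj_mult: "kcnj (a * b) = kcnj a * kcnj b"
    and kcnj_kcnj: "kcnj (kcnj a) = a"
    and mult_kcnj_scaleR: "a * kcnj a = (norm a)\<^sup>2 *\<^sub>R 1"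

instantiation real :: real_or_complex
begin
definition kcnj_real :: "real \<Rightarrow> real" where "kcnj_real r = r"
instance by standard (simp_all add: kcnj_real_def power2_eq_square)
end

instantiation complex :: real_or_complex
begin
definition kcnj_complex :: "complex \<Rightarrow> complex" where "kcnj_complex z = cnj z"
instance by standard (simp_all add: kcnj_complex_def flip: of_real_def complex_norm_square)
end

lemma mult_kcnj: "a * kcnj a = of_real ((norm a)\<^sup>2)" for a :: "'k::real_or_complex"
  by (simp add: mult_kcnj_scaleR of_real_def)

lemma add_kcnj_in_Reals: "a + kcnj a \<in> \<real>" for a :: "'k::real_or_complex"
proof -
  have one: "kcnj (1::'k) = 1"
    using mult_kcnj[of "1::'k"] by simp
  have "(1 + a) * kcnj (1 + a) = 1 + (a + kcnj a) + a * kcnj a"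
    by (simp add: kcnj_add one algebra_simps)
  then have "a + kcnj a = of_real ((norm (1 + a))\<^sup>2) - 1 - of_real ((norm a)\<^sup>2)"
    by (simp only: mult_kcnj) (simp add: algebra_simps)
  then show ?thesis by simp
qed

lemma kcnj_self_in_Reals: "a \<in> \<real>" if "kcnj a = a" for a :: "'k::real_or_complex"
proof -
  have "a + a \<in> \<real>" using add_kcnj_in_Reals[of a] that by simp
  then have "(a + a) / 2 \<in> \<real>" by (intro Reals_divide) simp_all
  then show ?thesis by simp
qed

lemma kcnj_of_real: "kcnj (of_real r) = (of_real r :: 'k::real_or_complex)"
proof (cases "r = 0")
  case True
  then show ?thesis using kcnj_add[of "0::'k" 0] by simp
next
  case False
  then have "of_real r * kcnj (of_real r :: 'k) = of_real r * of_real r"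
    by (simp add: mult_kcnj power2_eq_square)
  with False show ?thesis by simp
qed

lemma kcnj_minus: "kcnj (- a) = - kcnj a" for a :: "'k::real_or_complex"
  using kcnj_mult[of "- 1" a] kcnj_of_real[of "- 1", where 'k = 'k] by simp

lemma kcnj_diff: "kcnj (a - b) = kcnj a - kcnj b" for a :: "'k::real_or_complex"
  using kcnj_add[of a "- b"] by (simp add: kcnj_minus)

text \<open>
  The scalar field is the real line (first case) or it is spanned by 1 and a square root of
  -1 (second case). In the second case the norm is the modulus, by \<open>mult_kcnj\<close>.
\<close>

lemma real_or_complex_cases:
  "(\<forall>z::'k::real_or_complex. z \<in> \<real> \<and> kcnj z = z) \<or>
   (\<exists>i::'k. i * i = -1 \<and>
      (\<forall>z. \<exists>a b. z = of_real a + of_real b * i \<and> kcnj z = of_real a - of_real b * i))"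
proof (cases "\<forall>z::'k. kcnj z = z")
  case True
  then show ?thesis using kcnj_self_in_Reals by blast
next
  case False
  then obtain u :: 'k where u: "kcnj u \<noteq> u" by blast
  define w where "w = u - kcnj u"
  have w0: "w \<noteq> 0" using u by (auto simp: w_def)
  have cw: "kcnj w = - w"
    by (simp add: w_def kcnj_diff kcnj_kcnj)
  define i where "i = of_real (1 / norm w) * w"
  have ci: "kcnj i = - i" by (simp only: i_def kcnj_mult kcnj_of_real cw) simp
  have ni: "norm i = 1" using w0 by (simp add: i_def norm_mult norm_divide)
  have ii: "i * i = -1"
    using mult_kcnj[of i] by (simp add: ci ni) (metis minus_equation_iff)
  have "\<exists>a b. z = of_real a + of_real b * i \<and> kcnj z = of_real a - of_real b * i" for z
  proof -
    have "kcnj ((z - kcnj z) * i) = (z - kcnj z) * i"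
      by (simp add: kcnj_mult kcnj_diff kcnj_kcnj ci algebra_simps)
    then have "(z - kcnj z) * i \<in> \<real>" by (rule kcnj_self_in_Reals)
    then obtain b where b: "(z - kcnj z) * i = of_real b" by (auto elim: Reals_cases)
    obtain a where a: "z + kcnj z = of_real a"
      using add_kcnj_in_Reals[of z] by (auto elim: Reals_cases)
    have "(z - kcnj z) * i * i = of_real b * i" using b by simp
    then have d: "z - kcnj z = - of_real b * i" by (simp add: mult.assoc ii) (metis minus_diff_eq)
    have "z + z = (z + kcnj z) + (z - kcnj z)" "kcnj z + kcnj z = (z + kcnj z) - (z - kcnj z)"
      by simp_all
    then have "z + z = of_real a - of_real b * i" "kcnj z + kcnj z = of_real a + of_real b * i"
      unfolding a d by simp_all
    then have "z = of_real (a / 2) + of_real (- b / 2) * i \<and>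
               kcnj z = of_real (a / 2) - of_real (- b / 2) * i"
      by (simp add: field_simps)
    then show ?thesis by blast
  qed
  with ii show ?thesis by blast
qed

locale inner_product_space = vector_space scale
  for scale :: "'k::real_or_complex \<Rightarrow> 'v::ab_group_add \<Rightarrow> 'v" +
  fixes ip :: "'v \<Rightarrow> 'v \<Rightarrow> 'k"
  assumes ip_add_left: "ip (x + y) z = ip x z + ip y z"
    and ip_scale_left: "ip (scale c x) y = c * ip x y"
    and ip_commute: "ip x y = kcnj (ip y x)"
    and ip_self_nonneg: "\<exists>r\<ge>0. ip x x = of_real r"
    and ip_self_eq_0: "ip x x = 0 \<Longrightarrow> x = 0"

text \<open>
  The value \<open>ip x x\<close> is a nonnegative element of the scalar field; its modulus is that
  same number as an element of type \<^typ>\<open>real\<close>.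
\<close>

definition ip_norm :: "('v \<Rightarrow> 'v \<Rightarrow> 'k::real_or_complex) \<Rightarrow> 'v \<Rightarrow> real"
  where "ip_norm ip x = sqrt (norm (ip x x))"

lemma inner_product_space_real_inner:
  "inner_product_space scaleR (inner :: 'v::real_inner \<Rightarrow> 'v \<Rightarrow> real)"
  by unfold_locales
    (auto simp: inner_add_left inner_add_right inner_commute kcnj_real_def scaleR_right_distrib scaleR_left_distrib)

lemma ip_norm_inner: "ip_norm inner = (norm :: 'v::real_inner \<Rightarrow> real)"
  by (auto simp: ip_norm_def norm_eq_sqrt_inner)

lemma inner_product_space_complex:
  "inner_product_space (*) (\<lambda>z w :: complex. z * cnj w)"
proof unfold_locales
  show "\<exists>r\<ge>0. x * cnj x = of_real r" for x
    by (intro exI[of _ "(cmod x)\<^sup>2"] conjI complex_norm_square[symmetric]) simp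
qed (auto simp: kcnj_complex_def algebra_simps)

end

theory Submission
  imports Defs
begin

text \<open>
  Expanding the square of the norm of the linear combination of the \<open>y i\<close> with coefficients
  \<open>ip x (y i)\<close> and applying Hoelder's inequality to the double sum, with the moduli of the Gram
  matrix as weights, bounds it by weighted power sums; Cauchy--Schwarz then gives the first
  inequality. Each of the two power sums has three upper bounds: pull out the largest
  \<open>a i\<close>, apply Hoelder again, or pull out the largest \<open>Si i\<close>. The nine quantities
  arise from the nine pairs of choices.
\<close>

section \<open>Conjugation on the scalar field\<close>

lemma norm_kcnj: "norm (kcnj a) = norm a" for a :: "'k::real_or_complex"
proof (cases "a = 0")
  case True
  then show ?thesis using kcnj_of_real[of 0, where 'k = 'k] by simp
next
  case False
  \<comment> \<open>Both sides are the norm of \<open>a * kcnj a\<close>, which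
    \<open>mult_kcnj\<close> evaluates; cancelling \<open>norm a\<close> shows that conjugation is
    an isometry.\<close>
  have "norm a * norm (kcnj a) = norm a * norm a"
    unfolding norm_mult[symmetric] mult_kcnj by (simp add: norm_mult power2_eq_square)
  with False show ?thesis by simp
qed

lemma kcnj_sum: "kcnj (\<Sum>i\<in>I. f i) = (\<Sum>i\<in>I. kcnj (f i :: 'k::real_or_complex))"
proof (induction I rule: infinite_finite_induct)
qed (use kcnj_of_real[of 0, where 'k = 'k] in \<open>simp_all add: kcnj_add\<close>)

section \<open>Sesquilinearity, Cauchy--Schwarz and linear combinations\<close>

context inner_product_space
begin

lemma ip_zero_left: "ip 0 z = 0"
  using ip_add_left[of 0 0 z] by simp

lemma ip_diff_left: "ip (u - v) z = ip u z - ip v z"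
  using ip_add_left[of "u - v" v z] by (simp add: algebra_simps)

lemma ip_scale_right: "ip u (scale c v) = kcnj c * ip u v"
  by (metis ip_commute ip_scale_left kcnj_mult)

lemma ip_diff_right: "ip u (v - w) = ip u v - ip u w"
  by (metis ip_commute ip_diff_left kcnj_diff)

lemma ip_sum_left: "ip (\<Sum>i\<in>I. f i) z = (\<Sum>i\<in>I. ip (f i) z)"
  by (induction I rule: infinite_finite_induct) (simp_all add: ip_zero_left ip_add_left)

lemma ip_sum_right: "ip z (\<Sum>i\<in>I. f i) = (\<Sum>i\<in>I. ip z (f i))"
proof -
  have "ip z (\<Sum>i\<in>I. f i) = kcnj (\<Sum>i\<in>I. ip (f i) z)"
    by (metis ip_commute ip_sum_left)
  also have "\<dots> = (\<Sum>i\<in>I. ip z (f i))"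
    unfolding kcnj_sum by (intro sum.cong refl) (metis ip_commute)
  finally show ?thesis .
qed

lemma norm_ip_commute: "norm (ip u v) = norm (ip v u)"
  by (metis ip_commute norm_kcnj)

lemma ip_self: "ip u u = of_real (norm (ip u u))"
  using ip_self_nonneg[of u] by auto

lemma ip_norm_nonneg: "ip_norm ip u \<ge> 0"
  by (simp add: ip_norm_def)

text \<open>The part \<open>w\<close> of \<open>u\<close> orthogonal to \<open>v\<close> satisfies
  \<open>ip w w \<ge> 0\<close>, and this value is \<open>ip u u\<close> minus the squared modulus
  of \<open>ip u v\<close> divided by \<open>ip v v\<close>.\<close>

lemma ip_Cauchy_Schwarz: "norm (ip u v) \<le> ip_norm ip u * ip_norm ip v"
proof (cases "v = 0")
  case True
  then show ?thesis
    using norm_ip_commute[of u v] by (simp add: ip_zero_left ip_norm_def)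
next
  case False
  define A where "A = norm (ip u u)"
  define C where "C = norm (ip v v)"
  have A: "ip u u = of_real A" and C: "ip v v = of_real C"
    unfolding A_def C_def by (rule ip_self)+
  have C0: "C > 0"
    using False ip_self_eq_0[of v] by (auto simp: C_def)
  \<comment> \<open>The coefficient of the orthogonal projection of \<open>u\<close> onto the line
    through \<open>v\<close>.\<close>
  define c where "c = ip u v / ip v v"
  define w where "w = u - scale c v"
  have wv: "ip w v = 0"
    using C C0 by (simp add: w_def ip_diff_left ip_scale_left c_def)
  \<comment> \<open>Only the second argument is expanded to \<open>u - scale c v\<close>; its
    \<open>v\<close> part vanishes by orthogonality.\<close>
  have "ip w w = ip w u"
    using wv by (subst (2) w_def) (simp add: ip_diff_right ip_scale_right)
  also have "\<dots> = ip u u - c * ip v u"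
    by (simp add: w_def ip_diff_left ip_scale_left)
  also have "c * ip v u = (ip u v * kcnj (ip u v)) / ip v v"
    by (subst ip_commute[of v u]) (simp add: c_def)
  also have "ip u u - \<dots> = of_real (A - (norm (ip u v))\<^sup>2 / C)"
    by (simp add: A C mult_kcnj)
  finally have "ip w w = of_real (A - (norm (ip u v))\<^sup>2 / C)" .
  then have "A - (norm (ip u v))\<^sup>2 / C \<ge> 0"
    using ip_self_nonneg[of w] by (metis of_real_eq_iff)
  then have "(norm (ip u v))\<^sup>2 \<le> A * C"
    using C0 by (simp add: field_simps)
  then have "norm (ip u v) \<le> sqrt (A * C)"
    by (rule real_le_rsqrt)
  then show ?thesis
    by (simp add: ip_norm_def A_def C_def real_sqrt_mult)
qed

text \<open>Sesquilinear expansion into a double sum, followed by the triangle inequality in each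
  index; conjugating a coefficient does not change its modulus.\<close>

lemma ip_norm_lincomb_le:
  "(ip_norm ip (\<Sum>i\<in>I. scale (c i) (y i)))\<^sup>2
     \<le> (\<Sum>i\<in>I. \<Sum>j\<in>I. norm (c i) * norm (c j) * norm (ip (y i) (y j)))"
proof -
  have "(ip_norm ip (\<Sum>i\<in>I. scale (c i) (y i)))\<^sup>2
          = norm (\<Sum>i\<in>I. \<Sum>j\<in>I. c i * (kcnj (c j) * ip (y i) (y j)))"
    unfolding ip_norm_def
    by (simp add: ip_sum_left ip_sum_right ip_scale_left ip_scale_right sum_distrib_left
        mult.left_commute[of "kcnj _"]) (subst sum.swap, rule refl)
  also have "\<dots> \<le> (\<Sum>i\<in>I. norm (\<Sum>j\<in>I. c i * (kcnj (c j) * ip (y i) (y j))))"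
    by (rule norm_sum)
  also have "\<dots> \<le> (\<Sum>i\<in>I. \<Sum>j\<in>I. norm (c i * (kcnj (c j) * ip (y i) (y j))))"
    by (intro sum_mono norm_sum)
  finally show ?thesis
    by (simp add: norm_mult norm_kcnj mult.assoc)
qed

lemma sum_ip_squares_le:
  "(\<Sum>i\<in>I. (norm (ip x (y i)))\<^sup>2)
     \<le> ip_norm ip x * sqrt (\<Sum>i\<in>I. \<Sum>j\<in>I.
          norm (ip x (y i)) * norm (ip x (y j)) * norm (ip (y i) (y j)))"
proof -
  \<comment> \<open>With these coefficients conjugate linearity turns \<open>ip x u\<close> into the
    sum of squares itself, so Cauchy--Schwarz for \<open>x\<close> and \<open>u\<close>
    applies.\<close>
  define u where "u = (\<Sum>i\<in>I. scale (ip x (y i)) (y i))"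
  have "ip x u = of_real (\<Sum>i\<in>I. (norm (ip x (y i)))\<^sup>2)"
    by (simp add: u_def ip_sum_right ip_scale_right mult.commute[of "kcnj _"] mult_kcnj)
  then have "(\<Sum>i\<in>I. (norm (ip x (y i)))\<^sup>2) = norm (ip x u)"
    by (simp add: sum_nonneg del: of_real_sum of_real_power)
  also have "\<dots> \<le> ip_norm ip x * ip_norm ip u"
    by (rule ip_Cauchy_Schwarz)
  also have "\<dots> \<le> ip_norm ip x * sqrt (\<Sum>i\<in>I. \<Sum>j\<in>I.
          norm (ip x (y i)) * norm (ip x (y j)) * norm (ip (y i) (y j)))"
    unfolding u_def
    by (intro mult_left_mono real_le_rsqrt ip_norm_lincomb_le ip_norm_nonneg)
  finally show ?thesis .
qed

end

section \<open>Hoelder's inequality, plain and weighted\<close>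

lemma conjugate_exponent_gt_1:
  fixes p q :: real
  assumes "p > 1" "1 / p + 1 / q = 1"
  shows "q > 1"
proof -
  have "1 / p < 1" "1 / p > 0" using assms(1) by auto
  then have "1 / q > 0" "1 / q < 1" using assms(2) by linarith+
  then show ?thesis by (auto simp: zero_less_divide_iff divide_less_eq_1)
qed

text \<open>After scaling \<open>f\<close> and \<open>g\<close> to unit \<open>p\<close>-norm and
  \<open>q\<close>-norm, Young's inequality in each term sums to
  \<open>1 / p + 1 / q = 1\<close>.\<close>

lemma Hoelder_inequality_sum:
  fixes f g :: "'i \<Rightarrow> real" and p q :: real
  assumes "finite I" and p: "p > 1" and pq: "1 / p + 1 / q = 1"
    and f: "\<And>i. i \<in> I \<Longrightarrow> f i \<ge> 0" and g: "\<And>i. i \<in> I \<Longrightarrow> g i \<ge> 0"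
  shows "(\<Sum>i\<in>I. f i * g i)
           \<le> (\<Sum>i\<in>I. f i powr p) powr (1 / p) * (\<Sum>i\<in>I. g i powr q) powr (1 / q)"
proof -
  have q: "q > 1" using p pq by (rule conjugate_exponent_gt_1)
  define F where "F = (\<Sum>i\<in>I. f i powr p)"
  define G where "G = (\<Sum>i\<in>I. g i powr q)"
  have "F \<ge> 0" "G \<ge> 0" by (auto simp: F_def G_def intro: sum_nonneg)
  show ?thesis
  \<comment> \<open>Scaling divides by both norms; if one is zero, that function vanishes on
    \<open>I\<close> and so does the left side.\<close>
  proof (cases "F = 0 \<or> G = 0")
    case True
    then have "(\<forall>i\<in>I. f i = 0) \<or> (\<forall>i\<in>I. g i = 0)"
      using \<open>finite I\<close> by (auto simp: F_def G_def sum_nonneg_eq_0_iff)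
    then have "(\<Sum>i\<in>I. f i * g i) = 0" by (auto intro!: sum.neutral)
    then show ?thesis by simp
  next
    case False
    with \<open>F \<ge> 0\<close> \<open>G \<ge> 0\<close> have F: "F > 0" and G: "G > 0" by auto
    define s where "s = F powr (1 / p)"
    define t where "t = G powr (1 / q)"
    have s: "s > 0" "s powr p = F" and t: "t > 0" "t powr q = G"
      using F G p q by (auto simp: s_def t_def powr_powr)
    have "(\<Sum>i\<in>I. (f i / s) * (g i / t))
            \<le> (\<Sum>i\<in>I. (f i / s) powr p / p + (g i / t) powr q / q)"
      using p q pq f g s t by (intro sum_mono Youngs_inequality) auto
    also have "\<dots> = (\<Sum>i\<in>I. f i powr p) / F / p + (\<Sum>i\<in>I. g i powr q) / G / q"
      using s t f g
      by (simp add: sum.distrib powr_divide sum_divide_distrib)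
    also have "\<dots> = 1"
      using F G pq by (simp flip: F_def G_def)
    finally have "(\<Sum>i\<in>I. f i * g i) / (s * t) \<le> 1"
      by (simp add: sum_divide_distrib)
    then have "(\<Sum>i\<in>I. f i * g i) \<le> s * t"
      using s t by (simp add: field_simps)
    then show ?thesis by (simp add: s_def t_def F_def G_def)
  qed
qed

text \<open>Hoelder's inequality over \<open>I \<times> I\<close>: the weight is split as
  \<open>w powr (1 / p)\<close> times \<open>w powr (1 / q)\<close>, the first part going with
  \<open>a i\<close> and the second with \<open>a j\<close>.\<close>

lemma weighted_double_sum_le:
  fixes a :: "'i \<Rightarrow> real" and w :: "'i \<Rightarrow> 'i \<Rightarrow> real" and p q :: real
  assumes I: "finite I" and p: "p > 1" and pq: "1 / p + 1 / q = 1"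
    and a: "\<And>i. a i \<ge> 0" and w: "\<And>i j. w i j \<ge> 0" and sym: "\<And>i j. w i j = w j i"
  shows "(\<Sum>i\<in>I. \<Sum>j\<in>I. a i * a j * w i j)
           \<le> (\<Sum>i\<in>I. a i powr p * (\<Sum>j\<in>I. w i j)) powr (1 / p)
             * (\<Sum>i\<in>I. a i powr q * (\<Sum>j\<in>I. w i j)) powr (1 / q)"
proof -
  have q: "q > 1" using p pq by (rule conjugate_exponent_gt_1)
  have split_w: "a i * a j * w i j = (a i * w i j powr (1 / p)) * (a j * w i j powr (1 / q))" for i j
  proof -
    have "w i j powr (1 / p) * w i j powr (1 / q) = w i j"
      using w[of i j] pq by (simp flip: powr_add)
    then show ?thesis by (metis (no_types) mult.assoc mult.left_commute)
  qed
  have "(\<Sum>i\<in>I. \<Sum>j\<in>I. a i * a j * w i j)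
          = (\<Sum>(i, j)\<in>I \<times> I. (a i * w i j powr (1 / p)) * (a j * w i j powr (1 / q)))"
    unfolding sum.cartesian_product split_w ..
  also have "\<dots> \<le> (\<Sum>(i, j)\<in>I \<times> I. a i powr p * w i j) powr (1 / p)
                 * (\<Sum>(i, j)\<in>I \<times> I. a j powr q * w i j) powr (1 / q)"
    using Hoelder_inequality_sum[of "I \<times> I" p q
        "\<lambda>(i, j). a i * w i j powr (1 / p)" "\<lambda>(i, j). a j * w i j powr (1 / q)"]
      I p q pq a w
    by (simp add: case_prod_unfold powr_mult powr_powr)
  also have "(\<Sum>(i, j)\<in>I \<times> I. a i powr p * w i j) = (\<Sum>i\<in>I. a i powr p * (\<Sum>j\<in>I. w i j))"
    by (simp add: sum_distrib_left flip: sum.cartesian_product)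
  \<comment> \<open>Here the power depends on \<open>j\<close>, so swapping the sums produces column
    sums of \<open>w\<close>; symmetry makes them row sums.\<close>
  also have "(\<Sum>(i, j)\<in>I \<times> I. a j powr q * w i j) = (\<Sum>i\<in>I. a i powr q * (\<Sum>j\<in>I. w i j))"
    unfolding sum.cartesian_product[symmetric] sum_distrib_left
    by (subst sum.swap) (simp add: sym)
  finally show ?thesis .
qed

section \<open>Three bounds for a weighted power sum\<close>

lemma Max_powr:
  fixes f :: "'i \<Rightarrow> real"
  assumes "finite I" "I \<noteq> {}" "r \<ge> 0" "\<And>i. i \<in> I \<Longrightarrow> f i \<ge> 0"
  shows "(MAX i\<in>I. f i powr r) = (MAX i\<in>I. f i) powr r"
proof (rule Max_eqI)
  show "z \<le> (MAX i\<in>I. f i) powr r" if "z \<in> (\<lambda>i. f i powr r) ` I" for z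
    using that assms by (auto intro!: powr_mono2 Max_ge)
  have "(MAX i\<in>I. f i) \<in> f ` I" using assms by (intro Max_in) auto
  then show "(MAX i\<in>I. f i) powr r \<in> (\<lambda>i. f i powr r) ` I" by auto
qed (use assms in auto)

text \<open>Hoelder's inequality in its extreme case: \<open>f\<close> is the factor whose maximum
  is pulled out. The maximum is taken over powers to match the form of the nine quantities.\<close>

lemma sum_mult_powr_le_Max:
  fixes f g :: "'i \<Rightarrow> real"
  assumes I: "finite I" "I \<noteq> {}" and r: "r \<ge> 0"
    and f: "\<And>i. i \<in> I \<Longrightarrow> f i \<ge> 0" and g: "\<And>i. i \<in> I \<Longrightarrow> g i \<ge> 0"
  shows "(\<Sum>i\<in>I. f i * g i) powr r \<le> (MAX i\<in>I. f i powr r) * (\<Sum>i\<in>I. g i) powr r"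
proof -
  have "(\<Sum>i\<in>I. f i * g i) \<le> (MAX i\<in>I. f i) * (\<Sum>i\<in>I. g i)"
    unfolding sum_distrib_left using I g by (intro sum_mono mult_right_mono) auto
  then have "(\<Sum>i\<in>I. f i * g i) powr r \<le> ((MAX i\<in>I. f i) * (\<Sum>i\<in>I. g i)) powr r"
    using r f g by (intro powr_mono2 sum_nonneg) auto
  then show ?thesis
    using I r f by (simp add: powr_mult Max_powr)
qed

text \<open>Treats one factor of the right-hand side at a time; it is applied once with
  \<open>p\<close>, \<alpha>, \<beta> and once with \<open>q\<close>, \<gamma>, \<delta>. The 2 in
  the outer exponent comes from the square root of the double sum.\<close>

lemma weighted_power_sum_bounds:
  fixes a s :: "'i \<Rightarrow> real" and p \<alpha> \<beta> :: real
  assumes I: "finite I" "I \<noteq> {}" and p: "p > 0" and \<alpha>: "\<alpha> > 1" and \<alpha>\<beta>: "1 / \<alpha> + 1 / \<beta> = 1"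
    and a: "\<And>i. a i \<ge> 0" and s: "\<And>i. s i \<ge> 0"
  defines "P \<equiv> (\<Sum>i\<in>I. a i powr p * s i) powr (1 / (2 * p))"
  shows "P \<le> (MAX i\<in>I. a i powr (1 / 2)) * (\<Sum>i\<in>I. s i) powr (1 / (2 * p))"
    and "P \<le> (\<Sum>i\<in>I. a i powr (\<alpha> * p)) powr (1 / (2 * \<alpha> * p))
              * (\<Sum>i\<in>I. s i powr \<beta>) powr (1 / (2 * p * \<beta>))"
    and "P \<le> (\<Sum>i\<in>I. a i powr p) powr (1 / (2 * p)) * (MAX i\<in>I. s i powr (1 / (2 * p)))"
proof -
  show "P \<le> (MAX i\<in>I. a i powr (1 / 2)) * (\<Sum>i\<in>I. s i) powr (1 / (2 * p))"
    using sum_mult_powr_le_Max[of I "1 / (2 * p)" "\<lambda>i. a i powr p" s] I p a s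
    by (simp add: P_def powr_powr)
  show "P \<le> (\<Sum>i\<in>I. a i powr p) powr (1 / (2 * p)) * (MAX i\<in>I. s i powr (1 / (2 * p)))"
    using sum_mult_powr_le_Max[of I "1 / (2 * p)" s "\<lambda>i. a i powr p"] I p a s
    by (simp add: P_def mult.commute)
  \<comment> \<open>The middle bound: Hoelder's inequality with exponents \<alpha> and \<beta> for
    the functions \<open>a i powr p\<close> and \<open>s i\<close>.\<close>
  have "(\<Sum>i\<in>I. a i powr p * s i)
          \<le> (\<Sum>i\<in>I. (a i powr p) powr \<alpha>) powr (1 / \<alpha>) * (\<Sum>i\<in>I. s i powr \<beta>) powr (1 / \<beta>)"
    using I \<alpha> \<alpha>\<beta> s by (intro Hoelder_inequality_sum) auto
  then have "P \<le> ((\<Sum>i\<in>I. (a i powr p) powr \<alpha>) powr (1 / \<alpha>)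
                    * (\<Sum>i\<in>I. s i powr \<beta>) powr (1 / \<beta>)) powr (1 / (2 * p))"
    unfolding P_def using p s by (intro powr_mono2 sum_nonneg) auto
  then show "P \<le> (\<Sum>i\<in>I. a i powr (\<alpha> * p)) powr (1 / (2 * \<alpha> * p))
              * (\<Sum>i\<in>I. s i powr \<beta>) powr (1 / (2 * p * \<beta>))"
    by (simp add: powr_mult powr_powr mult_ac)
qed

section \<open>The first inequality and the nine upper bounds\<close>

theorem theorem3:
  fixes scale :: "'k::real_or_complex \<Rightarrow> 'v::ab_group_add \<Rightarrow> 'v"
    and ip :: "'v \<Rightarrow> 'v \<Rightarrow> 'k"
    and x :: 'v and y :: "nat \<Rightarrow> 'v" and n :: nat
    and p q \<alpha> \<beta> \<gamma> \<delta> :: real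
    and a Si :: "nat \<Rightarrow> real" and S R :: real
  assumes H: "inner_product_space scale ip"
    and n: "n \<ge> 1"
    and p: "p > 1" and pq: "1 / p + 1 / q = 1"
    and \<alpha>: "\<alpha> > 1" and \<alpha>\<beta>: "1 / \<alpha> + 1 / \<beta> = 1"
    and \<gamma>: "\<gamma> > 1" and \<gamma>\<delta>: "1 / \<gamma> + 1 / \<delta> = 1"
  defines "a \<equiv> \<lambda>i. norm (ip x (y i))"
    and "Si \<equiv> \<lambda>i. \<Sum>j=1..n. norm (ip (y i) (y j))"
    and "S \<equiv> \<Sum>i=1..n. \<Sum>j=1..n. norm (ip (y i) (y j))"
    and "R \<equiv> ip_norm ip x * (\<Sum>i=1..n. a i powr p * Si i) powr (1 / (2 * p))
                          * (\<Sum>i=1..n. a i powr q * Si i) powr (1 / (2 * q))"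
  shows "(\<Sum>i=1..n. (a i)\<^sup>2) \<le> R \<and>
         R \<le> ip_norm ip x * ((MAX i\<in>{1..n}. a i) * S powr (1 / 2)) \<and>
         R \<le> ip_norm ip x *
           ((MAX i\<in>{1..n}. a i powr (1 / 2)) *
            (\<Sum>i=1..n. a i powr (\<gamma> * q)) powr (1 / (2 * \<gamma> * q)) *
            S powr (1 / (2 * p)) *
            (\<Sum>i=1..n. Si i powr \<delta>) powr (1 / (2 * \<delta> * q))) \<and>
         R \<le> ip_norm ip x *
           ((MAX i\<in>{1..n}. a i powr (1 / 2)) *
            (\<Sum>i=1..n. a i powr q) powr (1 / (2 * q)) *
            S powr (1 / (2 * p)) *
            (MAX i\<in>{1..n}. Si i powr (1 / (2 * q)))) \<and>
         R \<le> ip_norm ip x *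
           ((MAX i\<in>{1..n}. a i powr (1 / 2)) *
            (\<Sum>i=1..n. a i powr (\<alpha> * p)) powr (1 / (2 * \<alpha> * p)) *
            S powr (1 / (2 * q)) *
            (\<Sum>i=1..n. Si i powr \<beta>) powr (1 / (2 * p * \<beta>))) \<and>
         R \<le> ip_norm ip x *
           ((\<Sum>i=1..n. a i powr (\<alpha> * p)) powr (1 / (2 * \<alpha> * p)) *
            (\<Sum>i=1..n. a i powr (\<gamma> * q)) powr (1 / (2 * \<gamma> * q)) *
            (\<Sum>i=1..n. Si i powr \<beta>) powr (1 / (2 * p * \<beta>)) *
            (\<Sum>i=1..n. Si i powr \<delta>) powr (1 / (2 * \<delta> * q))) \<and>
         R \<le> ip_norm ip x *
           ((\<Sum>i=1..n. a i powr q) powr (1 / (2 * q)) *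
            (\<Sum>i=1..n. a i powr (\<alpha> * p)) powr (1 / (2 * \<alpha> * p)) *
            (MAX i\<in>{1..n}. Si i powr (1 / (2 * q))) *
            (\<Sum>i=1..n. Si i powr \<beta>) powr (1 / (2 * p * \<beta>))) \<and>
         R \<le> ip_norm ip x *
           ((MAX i\<in>{1..n}. a i powr (1 / 2)) *
            (\<Sum>i=1..n. a i powr p) powr (1 / (2 * p)) *
            (MAX i\<in>{1..n}. Si i powr (1 / (2 * p))) *
            S powr (1 / (2 * q))) \<and>
         R \<le> ip_norm ip x *
           ((\<Sum>i=1..n. a i powr p) powr (1 / (2 * p)) *
            (\<Sum>i=1..n. a i powr (\<gamma> * q)) powr (1 / (2 * \<gamma> * q)) *
            (MAX i\<in>{1..n}. Si i powr (1 / (2 * p))) *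
            (\<Sum>i=1..n. Si i powr \<delta>) powr (1 / (2 * \<delta> * q))) \<and>
         R \<le> ip_norm ip x *
           ((\<Sum>i=1..n. a i powr p) powr (1 / (2 * p)) *
            (\<Sum>i=1..n. a i powr q) powr (1 / (2 * q)) *
            (MAX i\<in>{1..n}. Si i powr (1 / 2)))"
proof -
  interpret inner_product_space scale ip by (rule H)
  let ?I = "{1..n}"
  have I: "finite ?I" "?I \<noteq> {}" using n by auto
  have q: "q > 1" using p pq by (rule conjugate_exponent_gt_1)
  have p0: "p > 0" and q0: "q > 0" using p q by simp_all
  have a: "a i \<ge> 0" and Si: "Si i \<ge> 0" for i
    by (auto simp: a_def Si_def intro: sum_nonneg)
  have S: "(\<Sum>i\<in>?I. Si i) = S" by (simp add: S_def Si_def)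
  define N where "N = ip_norm ip x"
  define P where "P = (\<Sum>i=1..n. a i powr p * Si i) powr (1 / (2 * p))"
  define Q where "Q = (\<Sum>i=1..n. a i powr q * Si i) powr (1 / (2 * q))"
  have R: "R = N * (P * Q)" by (simp add: R_def N_def P_def Q_def mult.assoc)
  have N: "N \<ge> 0" by (simp add: N_def ip_norm_nonneg)

  note P_le = weighted_power_sum_bounds[where a = a and s = Si, OF I p0 \<alpha> \<alpha>\<beta> a Si, folded P_def, unfolded S]
  note Q_le = weighted_power_sum_bounds[where a = a and s = Si, OF I q0 \<gamma> \<gamma>\<delta> a Si, folded Q_def, unfolded S]
  \<comment> \<open>Any bound for \<open>P\<close> combines with any bound for \<open>Q\<close>. The
    product is named \<open>B\<close> separately so that its factors can be rearranged into the
    order of the statement.\<close>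
  have R_le: "R \<le> N * B" if "P \<le> C" "Q \<le> D" "C * D = B" for B C D
  proof -
    have "P \<ge> 0" "Q \<ge> 0" by (simp_all add: P_def Q_def)
    then have "P * Q \<le> C * D" using that by (intro mult_mono) auto
    then show ?thesis using N that(3) by (auto simp: R intro: mult_left_mono)
  qed
  have halves: "1 / (2 * p) + 1 / (2 * q) = 1 / 2" using pq p q by (simp add: field_simps)
  \<comment> \<open>By \<open>Max_powr\<close> both factors are powers of the same maximum, so the
    exponents add.\<close>
  have Max_halves: "(MAX i\<in>?I. f i powr r) * (MAX i\<in>?I. f i powr s) = (MAX i\<in>?I. f i powr (r + s))"
    if "\<And>i. f i \<ge> 0" "r \<ge> 0" "s \<ge> 0" for f :: "nat \<Rightarrow> real" and r s
    using Max_powr[OF I, of _ f] that powr_add[of "MAX i\<in>?I. f i" r s] by simp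

  have main: "(\<Sum>i=1..n. (a i)\<^sup>2) \<le> R"
  proof -
    \<comment> \<open>The double sum under the root in \<open>sum_ip_squares_le\<close>. Weighted
      Hoelder bounds it by the square of \<open>P * Q\<close>, because the exponents in
      \<open>P\<close> and \<open>Q\<close> are half of \<open>1 / p\<close> and
      \<open>1 / q\<close>.\<close>
    define T where "T = (\<Sum>i=1..n. \<Sum>j=1..n. a i * a j * norm (ip (y i) (y j)))"
    have "T \<le> (\<Sum>i=1..n. a i powr p * Si i) powr (1 / p) * (\<Sum>i=1..n. a i powr q * Si i) powr (1 / q)"
      unfolding T_def Si_def using I p pq a norm_ip_commute
      by (intro weighted_double_sum_le) auto
    also have "\<dots> = (P * Q)\<^sup>2"
    proof -
      have "(z powr (1 / (2 * r)))\<^sup>2 = z powr (1 / r)" for z r :: real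
      proof -
        have "(z powr (1 / (2 * r)))\<^sup>2 = z powr (1 / (2 * r) + 1 / (2 * r))"
          by (simp only: powr_add power2_eq_square)
        then show ?thesis by simp
      qed
      then show ?thesis by (simp add: P_def Q_def power_mult_distrib)
    qed
    finally have "sqrt T \<le> P * Q"
      by (intro real_le_lsqrt) (auto simp: P_def Q_def)
    moreover have "(\<Sum>i=1..n. (a i)\<^sup>2) \<le> N * sqrt T"
      unfolding a_def N_def T_def by (rule sum_ip_squares_le)
    ultimately show ?thesis
      using N by (auto simp: R intro: order_trans mult_left_mono)
  qed

  have S_halves: "S powr (1 / (2 * p)) * S powr (1 / (2 * q)) = S powr (1 / 2)"
    by (simp flip: powr_add add: halves)
  have a_halves: "(MAX i\<in>?I. a i powr (1 / 2)) * (MAX i\<in>?I. a i powr (1 / 2)) = (MAX i\<in>?I. a i)"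
    using Max_halves[of a "1 / 2" "1 / 2"] a by simp
  have Si_halves: "(MAX i\<in>?I. Si i powr (1 / (2 * p))) * (MAX i\<in>?I. Si i powr (1 / (2 * q)))
      = (MAX i\<in>?I. Si i powr (1 / 2))"
    using Max_halves[of Si "1 / (2 * p)" "1 / (2 * q)"] Si p q by (simp add: halves)
  have swap_\<delta>: "2 * q * \<delta> = 2 * \<delta> * q" by simp
  note Q_le = Q_le[unfolded swap_\<delta>]
  \<comment> \<open>The bounds of \<open>P\<close> and \<open>Q\<close> are paired in lexicographic
    order, which is the order of the nine quantities. Factors merge only in the first pair, where
    \<open>a_halves\<close> and \<open>S_halves\<close> apply, and in the last, where
    \<open>Si_halves\<close> does.\<close>
  show ?thesis
    unfolding N_def[symmetric]
    apply (intro conjI main)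
            apply (rule R_le[OF P_le(1) Q_le(1)], simp only: mult_ac a_halves[symmetric] S_halves[symmetric])
           apply (rule R_le[OF P_le(1) Q_le(2)], simp only: mult_ac)
          apply (rule R_le[OF P_le(1) Q_le(3)], simp only: mult_ac)
         apply (rule R_le[OF P_le(2) Q_le(1)], simp only: mult_ac)
        apply (rule R_le[OF P_le(2) Q_le(2)], simp only: mult_ac)
       apply (rule R_le[OF P_le(2) Q_le(3)], simp only: mult_ac)
      apply (rule R_le[OF P_le(3) Q_le(1)], simp only: mult_ac)
     apply (rule R_le[OF P_le(3) Q_le(2)], simp only: mult_ac)
    apply (rule R_le[OF P_le(3) Q_le(3)], simp only: mult_ac Si_halves[symmetric])
    done
qed

end
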